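(* Let $\mathcal X$ be a $C^r$ vector field, $r\ge 2$, defined in a neighborhood of the origin of $\mathbb R^2$, with $\mathcal X(0)=0$ and $A:=D\mathcal X(0)$ satisfying $A\neq0$, $A^2=0$. Then the restriction order $\nu(\mathcal X)$ is independent of the Jordan chain used to define the distinguished restriction $\mathcal R_{\mathcal X}$.
   Context: A Jordan chain of $A$ is a pair $(q_0,q_1)$ with $q_0\neq0$, $Aq_0=0$, $Aq_1=q_0$. Since $\ker A=\operatorname{im}A=\operatorname{span}\{q_0\}$, there is a unique scalar function $\mathcal R_{\mathcal X}$ defined near $0$ with $A\mathcal X(uq_0)=\mathcal R_{\mathcal X}(u)q_0$; it is the distinguished restriction associated with the chain. It satisfies $\mathcal R_{\mathcal X}(0)=\mathcal R_{\mathcal X}'(0)=0$, and its Taylor coefficients are denoted $g_k$: $\mathcal R_{\mathcal X}(u)=\sum_{k=2}^{r}g_ku^k+o(u^r)$ (with $g_k$ defined for every $k\ge2$ if $\mathcal R_{\mathcal X}$ is analytic near $0$). If $\mathcal R_{\mathcal X}\not\equiv0$, the restriction order is defined by $\nu(\mathcal X):=\operatorname{ord}_{u=0}\mathcal R_{\mathcal X}=\min\{k\ge2:\ g_k\neq0\}$; if $\mathcal R_{\mathcal X}\equiv0$, one sets $\nu(\mathcal X)=\infty$. *)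

theory Defs
  imports "HOL-Analysis.Analysis" "HOL-Library.Extended_Nat"
begin

text \<open>Continuous differentiability of finite order. For finite-dimensional domains, as used
  here, continuity of all iterated directional derivatives amounts to continuity of the iterated
  Frechet derivatives.\<close>

fun Ck_on :: "nat \<Rightarrow> ('a::real_normed_vector \<Rightarrow> 'b::real_normed_vector) \<Rightarrow> 'a set \<Rightarrow> bool" where
  "Ck_on 0 f U \<longleftrightarrow> continuous_on U f"
| "Ck_on (Suc n) f U \<longleftrightarrow>
     (\<forall>x\<in>U. f differentiable (at x)) \<and>
     (\<forall>v. Ck_on n (\<lambda>x. frechet_derivative f (at x) v) U)"

text \<open>The order is an extended natural number, so that \<open>r = \<infinity>\<close> covers smooth (in particular
  analytic) maps.\<close>

definition Cr_on :: "enat \<Rightarrow> ('a::real_normed_vector \<Rightarrow> 'b::real_normed_vector) \<Rightarrow> 'a set \<Rightarrow> bool" where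
  "Cr_on r f U \<longleftrightarrow> (\<forall>n. enat n \<le> r \<longrightarrow> Ck_on n f U)"

definition jordan_chain :: "real^2^2 \<Rightarrow> (real^2) \<times> (real^2) \<Rightarrow> bool" where
  "jordan_chain A q \<longleftrightarrow> fst q \<noteq> 0 \<and> A *v fst q = 0 \<and> A *v snd q = fst q"

text \<open>Only the germ at \<open>0\<close> matters: where \<open>X\<close> is a vector field on a neighbourhood \<open>U\<close> of the
  origin, the values at those \<open>u\<close> with \<open>u q\<^sub>0 \<notin> U\<close> are meaningless. The description is justified by
  \<open>jordan_chain_ex1\<close> below.\<close>

definition distinguished_restriction ::
    "(real^2 \<Rightarrow> real^2) \<Rightarrow> (real^2) \<times> (real^2) \<Rightarrow> real \<Rightarrow> real" where
  "distinguished_restriction X q u =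
     (THE c. jacobian X (at 0) *v X (u *\<^sub>R fst q) = c *\<^sub>R fst q)"

lemma jordan_chain_ex1:
  assumes "jordan_chain A q"
  shows "\<exists>!c. A *v x = c *\<^sub>R fst q"
proof -
  obtain p w where q: "q = (p, w)" by (cases q)
  have p: "p \<noteq> 0" "A *v p = 0" "A *v w = p"
    using assms by (auto simp: jordan_chain_def q)
  have "w \<notin> span {p}"
  proof
    assume "w \<in> span {p}"
    then obtain k where "w = k *\<^sub>R p" by (auto simp: span_singleton)
    then have "A *v w = k *\<^sub>R (A *v p)" by (simp add: matrix_vector_mult_scaleR)
    with p show False by simp
  qed
  then have ind: "independent {w, p}" and "card {w, p} = 2"
    using p span_base[of p "{p}"] by (auto simp: independent_insert card_insert_if)
  then have "UNIV \<subseteq> span {w, p}"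
    by (intro card_ge_dim_independent) (auto simp: dim_UNIV)
  then have "x \<in> span {w, p}" by blast
  then obtain a b where "x = a *\<^sub>R w + b *\<^sub>R p"
    by (auto simp: span_insert span_singleton algebra_simps)
  then have "A *v x = a *\<^sub>R p"
    using p by (simp add: matrix_vector_right_distrib matrix_vector_mult_scaleR)
  then show ?thesis using p by (auto simp: q)
qed

definition taylor_coeff :: "(real \<Rightarrow> real) \<Rightarrow> nat \<Rightarrow> real" where
  "taylor_coeff R k = (deriv ^^ k) R 0 / fact k"

text \<open>The indices \<open>k \<ge> 2\<close> for which the coefficient \<open>g\<^sub>k\<close> is defined: those up to the regularity
  \<open>r\<close>, and all of them if \<open>R\<close> is real analytic near \<open>0\<close>.\<close>

definition taylor_indices :: "enat \<Rightarrow> (real \<Rightarrow> real) \<Rightarrow> nat set" where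
  "taylor_indices r R = {k. 2 \<le> k \<and> (enat k \<le> r \<or> (\<exists>F. R has_fps_expansion F))}"

text \<open>\<open>None\<close> means that the order is undefined: \<open>R\<close> is not identically zero near \<open>0\<close>, but every
  defined coefficient vanishes (a remainder \<open>o(u^r)\<close> for finite \<open>r\<close>, or a flat function). This is
  kept apart from \<open>Some \<infinity>\<close>, which is the order of the zero germ.\<close>

definition vanishing_order :: "enat \<Rightarrow> (real \<Rightarrow> real) \<Rightarrow> enat option" where
  "vanishing_order r R =
     (if eventually (\<lambda>u. R u = 0) (nhds 0) then Some \<infinity>
      else if \<exists>k \<in> taylor_indices r R. taylor_coeff R k \<noteq> 0
      then Some (enat (LEAST k. k \<in> taylor_indices r R \<and> taylor_coeff R k \<noteq> 0))
      else None)"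

definition restriction_order ::
    "enat \<Rightarrow> (real^2 \<Rightarrow> real^2) \<Rightarrow> (real^2) \<times> (real^2) \<Rightarrow> enat option" where
  "restriction_order r X q = vanishing_order r (distinguished_restriction X q)"

end

theory Submission
  imports Defs
begin

text \<open>
  The image of \<open>A\<close> is a line, so the leading vectors of two Jordan chains are proportional, say
  \<open>p' = c p\<close> with \<open>c \<noteq> 0\<close>. Substituting into \<open>A X(u p) = R(u) p\<close> shows that the two distinguished
  restrictions differ by a linear change of the parameter and a constant factor:
  \<open>R'(u) = R(c u) / c\<close> (\<open>distinguished_restriction_scale\<close>). Such a change multiplies the \<open>k\<close>-th Taylor
  coefficient by \<open>c ^ (k - 1)\<close> and preserves both analyticity at \<open>0\<close> and the vanishing of the germ, so
  the order of vanishing does not change (\<open>vanishing_order_scale\<close>).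

  The subtle point is the chain rule for iterated derivatives: \<open>deriv\<close> returns an arbitrary value
  where the derivative does not exist, and such a value need not scale. At every index that enters the
  definition of the order, all derivatives of lower order are differentiable near \<open>0\<close>. Below the regularity
  of the vector field this is inherited from it (\<open>higher_deriv_differentiable_along_line\<close>); beyond it
  only analytic restrictions have Taylor coefficients, and power series can be differentiated termwise
  (\<open>has_fps_expansion_higher_deriv_differentiable\<close>).
\<close>

section \<open>Linear change of the parameter of a function germ\<close>

lemma filterlim_scale_nhds_0: "filterlim (\<lambda>u. c * u) (nhds 0) (nhds (0::'a::real_normed_field))"
proof -
  have "filterlim (\<lambda>u. c * u) (nhds (c * 0)) (nhds (0::'a))"
    by (intro tendsto_intros filterlim_ident)
  then show ?thesis by simp
qed

text \<open>Each use of the chain rule contributes one factor \<open>c\<close>. The identity is claimed on a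
  neighbourhood and not only at \<open>0\<close>, because the induction differentiates both sides once more.\<close>

lemma higher_deriv_scale:
  fixes f :: "'a::real_normed_field \<Rightarrow> 'a"
  assumes "\<And>j. j < k \<Longrightarrow> eventually (\<lambda>u. (deriv ^^ j) f field_differentiable at u) (nhds 0)"
  shows "eventually (\<lambda>u. (deriv ^^ k) (\<lambda>u. a * f (c * u)) u = a * c ^ k * (deriv ^^ k) f (c * u))
           (nhds 0)"
  using assms
proof (induction k)
  case 0
  then show ?case by simp
next
  case (Suc k)
  have "eventually (\<lambda>u. eventually (\<lambda>v. (deriv ^^ k) (\<lambda>u. a * f (c * u)) v =
          a * c ^ k * (deriv ^^ k) f (c * v)) (nhds u)) (nhds 0)"
    using Suc by (simp add: eventually_eventually)
  moreover have "eventually (\<lambda>u. (deriv ^^ k) f field_differentiable at (c * u)) (nhds 0)"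
    using Suc.prems[of k] filterlim_scale_nhds_0 by (auto dest: eventually_compose_filterlim)
  ultimately show ?case
  proof eventually_elim
    case (elim u)
    have "((deriv ^^ k) f has_field_derivative deriv ((deriv ^^ k) f) (c * u)) (at (c * u))"
      using elim(2) by (simp add: DERIV_deriv_iff_field_differentiable)
    then have "((\<lambda>v. (deriv ^^ k) f (c * v)) has_field_derivative
        deriv ((deriv ^^ k) f) (c * u) * c) (at u)"
      by (intro DERIV_chain2[where g = "\<lambda>v. c * v"]) (auto intro!: derivative_eq_intros)
    from DERIV_cmult[OF this, of "a * c ^ k"]
    have "deriv (\<lambda>v. a * c ^ k * (deriv ^^ k) f (c * v)) u =
        a * c ^ Suc k * deriv ((deriv ^^ k) f) (c * u)"
      by (simp add: DERIV_imp_deriv mult_ac)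
    with deriv_cong_ev[OF elim(1) refl] show ?case by simp
  qed
qed

lemma has_fps_expansion_scale:
  fixes f :: "'a::{banach,real_normed_field} \<Rightarrow> 'a"
  assumes "f has_fps_expansion F" and "c \<noteq> 0"
  shows "(\<lambda>u. f (c * u)) has_fps_expansion Abs_fps (\<lambda>n. c ^ n * fps_nth F n)"
proof -
  have "fps_conv_radius (Abs_fps (\<lambda>n. c ^ n * fps_nth F n)) = fps_conv_radius F / ereal (norm c)"
    using assms(2) by (simp add: fps_conv_radius_def conv_radius_mult_power)
  also have "\<dots> > 0"
    using assms by (cases "fps_conv_radius F") (auto simp: has_fps_expansion_def)
  finally have "fps_conv_radius (Abs_fps (\<lambda>n. c ^ n * fps_nth F n)) > 0" .
  moreover have "eventually (\<lambda>u. eval_fps F (c * u) = f (c * u)) (nhds 0)"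
    using assms(1) filterlim_scale_nhds_0
    by (auto simp: has_fps_expansion_def dest: eventually_compose_filterlim)
  moreover have "eval_fps (Abs_fps (\<lambda>n. c ^ n * fps_nth F n)) u = eval_fps F (c * u)" for u
    by (simp add: eval_fps_def power_mult_distrib mult_ac)
  ultimately show ?thesis by (simp add: has_fps_expansion_def)
qed

lemma has_fps_expansion_imp_differentiable:
  fixes f :: "'a::{banach,real_normed_field} \<Rightarrow> 'a"
  assumes "f has_fps_expansion F"
  shows "eventually (\<lambda>u. f field_differentiable at u) (nhds 0)"
proof -
  have "eventually (\<lambda>u. u \<in> eball 0 (fps_conv_radius F)) (nhds 0)"
    using assms by (intro eventually_nhds_in_open) (auto simp: has_fps_expansion_def zero_ereal_def)
  moreover have "eventually (\<lambda>u. eventually (\<lambda>v. eval_fps F v = f v) (nhds u)) (nhds 0)"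
    using assms by (simp add: eventually_eventually has_fps_expansion_def)
  ultimately show ?thesis
  proof eventually_elim
    case (elim u)
    then have "(eval_fps F has_field_derivative eval_fps (fps_deriv F) u) (at u)"
      by (intro has_field_derivative_eval_fps) (simp add: in_eball_iff)
    with elim(2) have "(f has_field_derivative eval_fps (fps_deriv F) u) (at u)"
      using DERIV_cong_ev by blast
    then show ?case by (auto simp: field_differentiable_def)
  qed
qed

lemma has_fps_expansion_higher_deriv_differentiable:
  fixes f :: "'a::{banach,real_normed_field} \<Rightarrow> 'a"
  assumes "f has_fps_expansion F"
  shows "eventually (\<lambda>u. (deriv ^^ j) f field_differentiable at u) (nhds 0)"
proof -
  have "(deriv ^^ j) f has_fps_expansion (fps_deriv ^^ j) F"
    by (induction j) (auto intro: has_fps_expansion_deriv assms)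
  then show ?thesis by (rule has_fps_expansion_imp_differentiable)
qed

text \<open>Invertible changes can be undone by a change of the same form, so it suffices to transfer
  each local property in one direction.\<close>

lemma iff_of_scale_invariant:
  fixes f :: "real \<Rightarrow> real"
  assumes "\<And>a c f. a \<noteq> 0 \<Longrightarrow> c \<noteq> 0 \<Longrightarrow> P f \<Longrightarrow> P (\<lambda>u. a * f (c * u))"
    and "a \<noteq> 0" and "c \<noteq> 0"
  shows "P (\<lambda>u. a * f (c * u)) \<longleftrightarrow> P f"
proof
  assume "P (\<lambda>u. a * f (c * u))"
  from assms(1)[OF _ _ this, of "1 / a" "1 / c"] show "P f"
    using assms(2,3) by simp
qed (rule assms(1)[OF assms(2,3)])

text \<open>The scaling factor \<open>a * c ^ k\<close> of the \<open>k\<close>-th Taylor coefficient is nonzero, and the set of indices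
  at which coefficients are defined is the same for both germs.\<close>

lemma vanishing_order_scale:
  assumes "a \<noteq> 0" and "c \<noteq> 0"
    and smooth: "\<And>j. enat j < r \<Longrightarrow>
      eventually (\<lambda>u. (deriv ^^ j) f field_differentiable at u) (nhds 0)"
  shows "vanishing_order r (\<lambda>u. a * f (c * u)) = vanishing_order r f"
proof -
  let ?g = "\<lambda>u. a * f (c * u)"
  have zero: "eventually (\<lambda>u. ?g u = 0) (nhds 0) \<longleftrightarrow> eventually (\<lambda>u. f u = 0) (nhds 0)"
  proof (rule iff_of_scale_invariant[where P = "\<lambda>h. eventually (\<lambda>u. h u = 0) (nhds 0)"])
    fix a c :: real and f :: "real \<Rightarrow> real"
    assume "eventually (\<lambda>u. f u = 0) (nhds 0)"
    then have "eventually (\<lambda>u. f (c * u) = 0) (nhds 0)"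
      using filterlim_scale_nhds_0 by (rule eventually_compose_filterlim)
    then show "eventually (\<lambda>u. a * f (c * u) = 0) (nhds 0)" by simp
  qed fact+
  have analytic: "(\<exists>F. ?g has_fps_expansion F) \<longleftrightarrow> (\<exists>F. f has_fps_expansion F)"
  proof (rule iff_of_scale_invariant[where P = "\<lambda>h. \<exists>F. h has_fps_expansion F"])
    fix a c :: real and f :: "real \<Rightarrow> real"
    assume "c \<noteq> 0" and "\<exists>F. f has_fps_expansion F"
    then show "\<exists>F. (\<lambda>u. a * f (c * u)) has_fps_expansion F"
      using has_fps_expansion_cmult_left has_fps_expansion_scale by blast
  qed fact+
  have indices: "taylor_indices r ?g = taylor_indices r f"
    using analytic by (simp add: taylor_indices_def)
  have coeff: "taylor_coeff ?g k \<noteq> 0 \<longleftrightarrow> taylor_coeff f k \<noteq> 0" if "k \<in> taylor_indices r f" for k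
  proof -
    have "eventually (\<lambda>u. (deriv ^^ j) f field_differentiable at u) (nhds 0)" if "j < k" for j
    proof (cases "\<exists>F. f has_fps_expansion F")
      case True
      then show ?thesis using has_fps_expansion_higher_deriv_differentiable by blast
    next
      case False
      with \<open>k \<in> taylor_indices r f\<close> have "enat k \<le> r" by (simp add: taylor_indices_def)
      with \<open>j < k\<close> show ?thesis by (intro smooth) (simp add: less_le_trans[of _ "enat k"])
    qed
    from eventually_nhds_x_imp_x[OF higher_deriv_scale[OF this]]
    have "(deriv ^^ k) ?g 0 = a * c ^ k * (deriv ^^ k) f 0" by simp
    then show ?thesis using assms(1,2) by (simp add: taylor_coeff_def)
  qed
  have "k \<in> taylor_indices r ?g \<and> taylor_coeff ?g k \<noteq> 0 \<longleftrightarrow>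
      k \<in> taylor_indices r f \<and> taylor_coeff f k \<noteq> 0" for k
    using indices coeff by blast
  then show ?thesis
    unfolding vanishing_order_def zero Bex_def by presburger
qed

section \<open>Regularity along a line\<close>

text \<open>Along the line spanned by \<open>p\<close>, differentiating in the parameter amounts to taking the directional
  derivative in the direction \<open>p\<close>, which has one order of regularity less; this drives the induction,
  which therefore ranges over all maps \<open>f\<close>.\<close>

lemma higher_deriv_differentiable_along_line:
  fixes f :: "'a::real_normed_vector \<Rightarrow> 'b::real_normed_vector" and L :: "'b \<Rightarrow> real"
  assumes "bounded_linear L" and "open U" and "Ck_on n f U" and "j < n" and "u *\<^sub>R p \<in> U"
  shows "(deriv ^^ j) (\<lambda>u. L (f (u *\<^sub>R p))) field_differentiable at u"
  using assms(3-5)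
proof (induction n arbitrary: f j u)
  case 0
  then show ?case by simp
next
  case (Suc n)
  let ?D = "\<lambda>x. frechet_derivative f (at x) p"
  have deriv: "((\<lambda>u. L (f (u *\<^sub>R p))) has_field_derivative L (?D (v *\<^sub>R p))) (at v)"
    if "v *\<^sub>R p \<in> U" for v
  proof -
    have f: "(f has_derivative frechet_derivative f (at (v *\<^sub>R p))) (at (v *\<^sub>R p))"
      using Suc.prems(1) that by (simp add: frechet_derivative_works)
    have "((\<lambda>u. f (u *\<^sub>R p)) has_derivative
        (\<lambda>t. frechet_derivative f (at (v *\<^sub>R p)) (t *\<^sub>R p))) (at v)"
      by (rule has_derivative_compose[where f = "\<lambda>u. u *\<^sub>R p", OF _ f])
         (auto intro!: derivative_eq_intros)
    from bounded_linear.has_derivative[OF assms(1) this]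
    have "((\<lambda>u. L (f (u *\<^sub>R p))) has_derivative
        (\<lambda>t. L (frechet_derivative f (at (v *\<^sub>R p)) (t *\<^sub>R p)))) (at v)" .
    moreover have "L (frechet_derivative f (at (v *\<^sub>R p)) (t *\<^sub>R p)) = L (?D (v *\<^sub>R p)) * t" for t
      using has_derivative_bounded_linear[OF f] assms(1)
      by (simp add: bounded_linear.linear linear_scale)
    ultimately show ?thesis by (simp add: has_field_derivative_def)
  qed
  show ?case
  proof (cases j)
    case 0
    then show ?thesis using deriv[OF Suc.prems(3)] by (auto simp: field_differentiable_def)
  next
    case (Suc i)
    have "Ck_on n ?D U" using Suc.prems(1) by simp
    then have diff: "(deriv ^^ i) (\<lambda>u. L (?D (u *\<^sub>R p))) field_differentiable at u"
      using Suc Suc.prems(2,3) Suc.IH by simp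
    have "open {v. v *\<^sub>R p \<in> U}"
      using open_vimage[OF assms(2), of "\<lambda>v. v *\<^sub>R p"] by (simp add: vimage_def continuous_intros)
    then have "eventually (\<lambda>v. v *\<^sub>R p \<in> U) (nhds u)"
      using eventually_nhds_in_open Suc.prems(3) by fastforce
    then have "eventually (\<lambda>v. deriv (\<lambda>u. L (f (u *\<^sub>R p))) v = L (?D (v *\<^sub>R p))) (nhds u)"
      by eventually_elim (rule DERIV_imp_deriv[OF deriv])
    then have "eventually (\<lambda>w. eventually (\<lambda>v. deriv (\<lambda>u. L (f (u *\<^sub>R p))) v = L (?D (v *\<^sub>R p)))
        (nhds w)) (nhds u)"
      by (simp add: eventually_eventually)
    then have "eventually (\<lambda>w. (deriv ^^ j) (\<lambda>u. L (f (u *\<^sub>R p))) w =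
        (deriv ^^ i) (\<lambda>u. L (?D (u *\<^sub>R p))) w) (nhds u)"
      unfolding \<open>j = Suc i\<close> funpow_Suc_right o_apply
      by eventually_elim (rule higher_deriv_cong_ev[OF _ refl])
    with diff show ?thesis
      unfolding field_differentiable_def using DERIV_cong_ev by blast
  qed
qed

section \<open>Changing the Jordan chain\<close>

lemma distinguished_restriction_eqI:
  assumes "jordan_chain (jacobian X (at 0)) q"
    and "jacobian X (at 0) *v X (u *\<^sub>R fst q) = c *\<^sub>R fst q"
  shows "distinguished_restriction X q u = c"
  unfolding distinguished_restriction_def
  using jordan_chain_ex1[OF assms(1)] assms(2) by (rule the1_equality)

lemma distinguished_restriction_works:
  assumes "jordan_chain (jacobian X (at 0)) q"
  shows "jacobian X (at 0) *v X (u *\<^sub>R fst q) = distinguished_restriction X q u *\<^sub>R fst q"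
  unfolding distinguished_restriction_def by (rule theI'[OF jordan_chain_ex1[OF assms]])

text \<open>The image of \<open>A\<close> is spanned by the leading vector of either chain, and contains the leading
  vector of the other one as the image of its second vector.\<close>

lemma jordan_chain_proportional:
  assumes "jordan_chain A q" and "jordan_chain A q'"
  obtains c where "c \<noteq> 0" and "fst q' = c *\<^sub>R fst q"
proof -
  obtain c where "A *v snd q' = c *\<^sub>R fst q"
    using jordan_chain_ex1[OF assms(1)] by blast
  with assms(2) have "fst q' = c *\<^sub>R fst q" "c \<noteq> 0"
    by (auto simp: jordan_chain_def)
  then show thesis by (rule that[rotated])
qed

lemma distinguished_restriction_scale:
  assumes "jordan_chain (jacobian X (at 0)) q" and "jordan_chain (jacobian X (at 0)) q'"
    and "c \<noteq> 0" and "fst q' = c *\<^sub>R fst q"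
  shows "distinguished_restriction X q' = (\<lambda>u. 1 / c * distinguished_restriction X q (c * u))"
proof
  fix u
  show "distinguished_restriction X q' u = 1 / c * distinguished_restriction X q (c * u)"
    using distinguished_restriction_works[OF assms(1), of "c * u"] assms(3,4)
    by (intro distinguished_restriction_eqI[OF assms(2)]) (simp add: mult.commute)
qed

text \<open>The coordinate of a vector on the line spanned by the leading vector is its normalised inner product with
  that vector; it exhibits the distinguished restriction as a linear functional of the vector field.\<close>

lemma distinguished_restriction_eq_inner:
  assumes "jordan_chain (jacobian X (at 0)) q"
  shows "distinguished_restriction X q =
    (\<lambda>u. (jacobian X (at 0) *v X (u *\<^sub>R fst q)) \<bullet> fst q / (fst q \<bullet> fst q))"
  using distinguished_restriction_works[OF assms] assms by (auto simp: jordan_chain_def)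

lemma distinguished_restriction_higher_deriv_differentiable:
  assumes "open U" and "0 \<in> U" and "Cr_on r X U"
    and "jordan_chain (jacobian X (at 0)) q" and "enat j < r"
  shows "eventually (\<lambda>u. (deriv ^^ j) (distinguished_restriction X q) field_differentiable at u)
           (nhds 0)"
proof -
  define L where "L = (\<lambda>x. (jacobian X (at 0) *v x) \<bullet> fst q / (fst q \<bullet> fst q))"
  have "bounded_linear L"
    unfolding L_def
    by (intro bounded_linear_divide[THEN bounded_linear_compose] matrix_vector_mul_bounded_linear
        bounded_linear_inner_left[THEN bounded_linear_compose])
  moreover have "Ck_on (Suc j) X U"
    using assms(3) ileI1[OF assms(5)] unfolding Cr_on_def eSuc_enat by blast
  ultimately have "(deriv ^^ j) (distinguished_restriction X q) field_differentiable at u"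
    if "u *\<^sub>R fst q \<in> U" for u
    using higher_deriv_differentiable_along_line[OF _ assms(1) _ lessI that, of L j X]
    unfolding distinguished_restriction_eq_inner[OF assms(4)] L_def by blast
  moreover have "eventually (\<lambda>u. u *\<^sub>R fst q \<in> U) (nhds 0)"
  proof -
    have "filterlim (\<lambda>u. u *\<^sub>R fst q) (nhds (0 *\<^sub>R fst q)) (nhds 0)"
      by (intro tendsto_intros filterlim_ident)
    then show ?thesis using assms(1,2) topological_tendstoD by fastforce
  qed
  ultimately show ?thesis by (auto elim: eventually_mono)
qed

theorem corollary3p6:
  fixes X :: "real^2 \<Rightarrow> real^2" and U :: "(real^2) set" and r :: enat and A :: "real^2^2"
    and q q' :: "(real^2) \<times> (real^2)"
  assumes "2 \<le> r"
    and "open U" and "0 \<in> U" and "Cr_on r X U"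
    and "X 0 = 0"
    and "A = jacobian X (at 0)" and "A \<noteq> 0" and "A ** A = 0"
    and "jordan_chain A q" and "jordan_chain A q'"
  shows "restriction_order r X q = restriction_order r X q'"
proof -
  have chains: "jordan_chain (jacobian X (at 0)) q" "jordan_chain (jacobian X (at 0)) q'"
    using assms(6,9,10) by simp_all
  then obtain c where c: "c \<noteq> 0" "fst q' = c *\<^sub>R fst q"
    by (rule jordan_chain_proportional)
  have "vanishing_order r (\<lambda>u. 1 / c * distinguished_restriction X q (c * u)) =
      vanishing_order r (distinguished_restriction X q)"
    using c(1) distinguished_restriction_higher_deriv_differentiable[OF assms(2-4) chains(1)]
    by (intro vanishing_order_scale) auto
  then show ?thesis
    by (simp only: restriction_order_def distinguished_restriction_scale[OF chains c])
qed

end
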